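(* Let $G=(V_0,V_1,E)$ be a game structure with priority function $\alpha:V\to[d]$, let $M=[d]$, and let $V\times M$ be equipped with the partial order $\preceq$ defined in the context. If $U\subseteq V\times M$ is a closed set, then $\mathsf{Cpre}_0(G\times M,U)$ is closed. Moreover, let $A=\lceil U\rceil$ be the antichain representing $U$. Then $\lceil\mathsf{Cpre}_0(G\times M,U)\rceil=\lceil B_0\cup B_1\rceil$, where $B_0,B_1$ are the following antichains: $$B_0=\bigcup_{v\in V_0}\Big\lceil\{(v,\mathrm{down}(m',\alpha(v)))\mid(v,v')\in E,\ (v',m')\in A\}\Big\rceil,$$ $$B_1=\bigcup_{v\in V_1}\Big\lceil\mathop{\sqcap}_{(v,v')\in E}\big\lceil\{(v,\mathrm{down}(m',\alpha(v)))\mid(v',m')\in A\}\big\rceil\Big\rceil.$$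
   Context: A game structure $G=(V_0,V_1,E)$ consists of a finite directed graph $(V,E)$ with $V=V_0\sqcup V_1$ ($V_i$ controlled by player $i$) in which every vertex has an outgoing edge. $[d]=\{0,\dots,d\}$. The extended structure $G\times M$ has vertex set $V\times M$, player $i$ controls $V_i\times M$, and its edge set $E_M$ consists of the pairs $((v,m),(v',m'))$ with $(v,v')\in E$ and $m'=\max\{m,\alpha(v)\}$. For $U\subseteq V\times M$, $\mathsf{Cpre}_0(G\times M,U)=C_0\cup C_1$ with $C_0=\{(v,m)\in V_0\times M\mid\exists((v,m),(v',m'))\in E_M,\ (v',m')\in U\}$ and $C_1=\{(v,m)\in V_1\times M\mid\forall((v,m),(v',m'))\in E_M,\ (v',m')\in U\}$. Partial order on $V\times M$: $(v',m')\prec(v,m)$ iff $v=v'$ and either ($m,m'$ are even and $m'>m$), or ($m,m'$ are odd and $m'<m$), or ($m$ is odd and $m'$ is even). $(v',m')\preceq(v,m)$ iff $(v',m')=(v,m)$ or $(v',m')\prec(v,m)$. A set $R\subseteq V\times M$ is closed if $s\in R$ and $s'\preceq s$ imply $s'\in R$. $\lceil R\rceil$ is the set of $\preceq$-maximal elements of $R$. An antichain is a set of pairwise incomparable elements; a closed set $R$ is represented by the antichain $\lceil R\rceil$. For elements, $s\sqcap s'$ is the greatest lower bound; for sets, $R\sqcap R'=\{s\sqcap s'\mid s\in R,s'\in R'\}$ (empty if $R$ or $R'$ is empty), and $\mathop{\sqcap}_{(v,v')\in E}$ denotes the iterated operation over the successors $v'$ of $v$. (In the formulas all the sets combined by $\sqcap$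 lie in a single $\{v\}\times M$, where greatest lower bounds exist.) For $m',p\in[d]$, $\mathrm{down}(m',p)$ is defined as follows. If $p$ is even: $\mathrm{down}(m',p)=m'$ if $p<m'$, and $\max\{p-1,0\}$ otherwise. If $p$ is odd: $\mathrm{down}(m',p)=m'$ if $p\le m'$, and otherwise $p+1$, except that if $p=d$ (and $p>m'$) it is not defined. In the sets defining $B_0,B_1$, elements for which $\mathrm{down}$ is not defined are omitted. *)

theory Defs
  imports "HOL-Library.FuncSet"
begin

locale game_structure =
  fixes V0 V1 :: "'v set" and E :: "('v \<times> 'v) set"
  assumes finite_V0: "finite V0"
    and finite_V1: "finite V1"
    and disjoint: "V0 \<inter> V1 = {}"
    and edges: "E \<subseteq> (V0 \<union> V1) \<times> (V0 \<union> V1)"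
    and total: "\<forall>v\<in>V0 \<union> V1. \<exists>v'. (v, v') \<in> E"

text \<open>The edge relation of the extended structure \<open>G \<times> M\<close>. Player \<open>i\<close> controls \<open>V\<^sub>i \<times> M\<close> in it.\<close>

definition ext_edges ::
  "('v \<times> 'v) set \<Rightarrow> ('v \<Rightarrow> nat) \<Rightarrow> nat set \<Rightarrow> (('v \<times> nat) \<times> ('v \<times> nat)) set" where
  "ext_edges E \<alpha> M =
     {((v, m), (v', m')) | v m v' m'. m \<in> M \<and> m' \<in> M \<and> (v, v') \<in> E \<and> m' = max m (\<alpha> v)}"

text \<open>The player-0 controllable predecessor in an arbitrary structure in which player 0 controls
  \<open>W0\<close>, player 1 controls \<open>W1\<close>, and the edge relation is \<open>F\<close>.\<close>

definition Cpre0 :: "'s set \<Rightarrow> 's set \<Rightarrow> ('s \<times> 's) set \<Rightarrow> 's set \<Rightarrow> 's set" where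
  "Cpre0 W0 W1 F U =
     {s \<in> W0. \<exists>s'. (s, s') \<in> F \<and> s' \<in> U} \<union>
     {s \<in> W1. \<forall>s'. (s, s') \<in> F \<longrightarrow> s' \<in> U}"

definition prec :: "'v \<times> nat \<Rightarrow> 'v \<times> nat \<Rightarrow> bool"  (infix "\<prec>" 50) where
  "s' \<prec> s \<longleftrightarrow> (case (s', s) of ((v', m'), (v, m)) \<Rightarrow>
     v = v' \<and>
     (even m \<and> even m' \<and> m' > m \<or>
      odd m \<and> odd m' \<and> m' < m \<or>
      odd m \<and> even m'))"

definition preceq :: "'v \<times> nat \<Rightarrow> 'v \<times> nat \<Rightarrow> bool"  (infix "\<preceq>" 50) where
  "s' \<preceq> s \<longleftrightarrow> s' = s \<or> s' \<prec> s"

text \<open>The order lives on the carrier \<open>S = V \<times> M\<close>, not on the whole type: closedness and greatest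
  lower bounds are relative to \<open>S\<close>.\<close>

definition closed_in :: "('v \<times> nat) set \<Rightarrow> ('v \<times> nat) set \<Rightarrow> bool" where
  "closed_in S R \<longleftrightarrow> R \<subseteq> S \<and> (\<forall>s\<in>R. \<forall>s'\<in>S. s' \<preceq> s \<longrightarrow> s' \<in> R)"

definition maxels :: "('v \<times> nat) set \<Rightarrow> ('v \<times> nat) set"  ("\<lceil>\<lceil>_\<rceil>\<rceil>") where
  "\<lceil>\<lceil>R\<rceil>\<rceil> = {s \<in> R. \<not> (\<exists>s'\<in>R. s \<prec> s')}"

definition antichain :: "('v \<times> nat) set \<Rightarrow> bool" where
  "antichain R \<longleftrightarrow> (\<forall>s\<in>R. \<forall>s'\<in>R. s \<noteq> s' \<longrightarrow> \<not> s \<preceq> s' \<and> \<not> s' \<preceq> s)"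

definition is_glb ::
  "('v \<times> nat) set \<Rightarrow> 'v \<times> nat \<Rightarrow> 'v \<times> nat \<Rightarrow> 'v \<times> nat \<Rightarrow> bool" where
  "is_glb S s s' g \<longleftrightarrow>
     g \<in> S \<and> g \<preceq> s \<and> g \<preceq> s' \<and> (\<forall>h\<in>S. h \<preceq> s \<and> h \<preceq> s' \<longrightarrow> h \<preceq> g)"

text \<open>The set \<open>{s \<sqinter> s' | s \<in> R, s' \<in> R'}\<close>. Elements with different first components have no lower
  bound at all; such pairs contribute nothing.\<close>

definition set_meet ::
  "('v \<times> nat) set \<Rightarrow> ('v \<times> nat) set \<Rightarrow> ('v \<times> nat) set \<Rightarrow> ('v \<times> nat) set" where
  "set_meet S R R' = {g. \<exists>s\<in>R. \<exists>s'\<in>R'. is_glb S s s' g}"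

fun list_meet :: "('v \<times> nat) set \<Rightarrow> ('v \<times> nat) set list \<Rightarrow> ('v \<times> nat) set" where
  "list_meet S [] = S"
| "list_meet S [R] = R"
| "list_meet S (R # R' # Rs) = set_meet S R (list_meet S (R' # Rs))"

text \<open>The iterated meet of the family \<open>F\<close> over a finite nonempty index set \<open>I\<close>. The result does not
  depend on the enumeration of \<open>I\<close>, because \<^term>\<open>set_meet S\<close> is commutative and associative on
  subsets of one fibre \<open>{v} \<times> M\<close>, which is a finite chain. The value of \<^const>\<open>list_meet\<close> on
  the empty list is a dummy: every vertex has a successor.\<close>

definition big_meet ::
  "('v \<times> nat) set \<Rightarrow> ('i \<Rightarrow> ('v \<times> nat) set) \<Rightarrow> 'i set \<Rightarrow> ('v \<times> nat) set" where
  "big_meet S F I = list_meet S (map F (SOME xs. distinct xs \<and> set xs = I))"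

text \<open>\<^const>\<open>None\<close> means that the value is not defined.\<close>

definition down :: "nat \<Rightarrow> nat \<Rightarrow> nat \<Rightarrow> nat option" where
  "down d m' p =
     (if even p then (if p < m' then Some m' else Some (max (p - 1) 0))
      else if p \<le> m' then Some m'
      else if p = d then None
      else Some (p + 1))"

definition B0 ::
  "nat \<Rightarrow> 'v set \<Rightarrow> ('v \<times> 'v) set \<Rightarrow> ('v \<Rightarrow> nat) \<Rightarrow> ('v \<times> nat) set \<Rightarrow> ('v \<times> nat) set" where
  "B0 d V0 E \<alpha> A =
     (\<Union>v\<in>V0. \<lceil>\<lceil>{(v, k) | k v' m'. (v, v') \<in> E \<and> (v', m') \<in> A \<and> down d m' (\<alpha> v) = Some k}\<rceil>\<rceil>)"

definition B1 ::
  "('v \<times> nat) set \<Rightarrow> nat \<Rightarrow> 'v set \<Rightarrow> ('v \<times> 'v) set \<Rightarrow> ('v \<Rightarrow> nat) \<Rightarrow> ('v \<times> nat) set \<Rightarrow> ('v \<times> nat) set"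
  where
  "B1 S d V1 E \<alpha> A =
     (\<Union>v\<in>V1. \<lceil>\<lceil>big_meet S
        (\<lambda>v'. \<lceil>\<lceil>{(v, k) | k m'. (v', m') \<in> A \<and> down d m' (\<alpha> v) = Some k}\<rceil>\<rceil>)
        {v'. (v, v') \<in> E}\<rceil>\<rceil>)"

end

theory Submission
  imports Defs
begin

text \<open>On each fibre \<open>{v} \<times> M\<close> the order is the one induced by the injective rank \<open>rk m = \<plusminus>m\<close>, with the
  sign positive iff \<open>m\<close> is odd. The function \<open>down\<close> is the (partial) upper adjoint of
  \<open>m \<mapsto> max m p\<close> for this order, so \<open>(v', max m p)\<close> lies in the closed set \<open>U\<close> iff \<open>m\<close> is below
  \<open>down m' p\<close> for some \<open>(v', m') \<in> \<lceil>U\<rceil>\<close>. An existential choice of successor then becomes a union,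
  a universal one a meet. It follows that \<open>B\<^sub>0 \<union> B\<^sub>1\<close> is a cofinal subset of the controllable
  predecessor, and a cofinal subset has the same maximal elements.\<close>

definition rk :: "nat \<Rightarrow> int" where
  "rk m = (if odd m then int m else - int m)"

lemma rk_eq_iff [simp]: "rk m = rk n \<longleftrightarrow> m = n"
  by (cases "m = 0"; cases "n = 0") (auto simp: rk_def)

lemma preceq_iff: "s' \<preceq> s \<longleftrightarrow> fst s' = fst s \<and> rk (snd s') \<le> rk (snd s)"
proof -
  \<comment> \<open>Strict positivity separates the odd ranks from the even ones, which are at most
    \<open>0\<close>.\<close>
  have *: "0 < m" if "odd m" for m :: nat
    using that by (rule odd_pos)
  show ?thesis
    by (cases s'; cases s) (auto simp: preceq_def prec_def rk_def dest: *)
qed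

lemma prec_iff: "s' \<prec> s \<longleftrightarrow> fst s' = fst s \<and> rk (snd s') < rk (snd s)"
proof -
  have *: "0 < m" if "odd m" for m :: nat
    using that by (rule odd_pos)
  show ?thesis
    by (cases s'; cases s) (auto simp: prec_def rk_def dest: *)
qed

lemma preceq_refl: "s \<preceq> s"
  by (simp add: preceq_def)

lemma preceq_trans: "s \<preceq> t \<Longrightarrow> t \<preceq> u \<Longrightarrow> s \<preceq> u"
  by (auto simp: preceq_iff)

lemma prec_preceq_trans: "s \<prec> t \<Longrightarrow> t \<preceq> u \<Longrightarrow> s \<prec> u"
  by (auto simp: preceq_iff prec_iff)

section \<open>Adjointness of \<open>down\<close> and the priority update\<close>

lemma down_le: "m' \<le> d \<Longrightarrow> p \<le> d \<Longrightarrow> down d m' p = Some k \<Longrightarrow> k \<le> d"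
  by (auto simp: down_def split: if_splits)

text \<open>If \<open>p < m'\<close>, or \<open>p = m'\<close> is odd, taking the maximum with
  \<open>p\<close> does not affect the comparison with \<open>m'\<close>. Otherwise an odd maximum
  exceeds \<open>m'\<close>, and an even one is at least \<open>m'\<close>, so the left side says
  just that \<open>max m p\<close> is even. For even \<open>p\<close> this fails only for odd
  \<open>m > p\<close>, which gives the bound \<open>p - 1\<close>; for odd \<open>p\<close> it
  requires an even \<open>m \<ge> p + 1\<close>, which is impossible if
  \<open>p = d\<close>.\<close>

lemma down_adjoint:
  assumes "m \<le> d" "m' \<le> d" "p \<le> d"
  shows "rk (max m p) \<le> rk m' \<longleftrightarrow> (\<exists>k. down d m' p = Some k \<and> rk m \<le> rk k)"
proof (cases "even p")
  case True
  show ?thesis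
  proof (cases "p < m'")
    case p: True
    then show ?thesis
      using True by (auto simp: down_def rk_def max_def elim!: evenE oddE)
  next
    case False
    then show ?thesis
      using True
      \<comment> \<open>At \<open>p = 0\<close> the bound is \<open>0\<close>: exactly the even
        \<open>m\<close> qualify, and \<open>0\<close> has the largest even rank.\<close>
      by (cases "p = 0"; auto simp: down_def rk_def max_def elim!: evenE oddE; presburger)
  qed
next
  case False
  then show ?thesis
    using assms
    by (cases "p \<le> m'"; cases "p = d";
        auto simp: down_def rk_def max_def elim!: evenE oddE; presburger)
qed

section \<open>Maximal elements and cofinality\<close>

lemma maxels_subset: "\<lceil>\<lceil>R\<rceil>\<rceil> \<subseteq> R"
  by (auto simp: maxels_def)

text \<open>The elements of \<open>R\<close> above \<open>s\<close> lie in one fibre, so one of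
  largest rank exists among them; anything in \<open>R\<close> strictly above it would again be
  above \<open>s\<close>.\<close>

lemma maxels_cofinal:
  assumes "finite R" "s \<in> R"
  shows "\<exists>t\<in>\<lceil>\<lceil>R\<rceil>\<rceil>. s \<preceq> t"
proof -
  define T where "T = {t \<in> R. s \<preceq> t}"
  have "finite T" "T \<noteq> {}"
    using assms preceq_refl[of s] unfolding T_def by (simp, blast)
  then obtain t where t: "t \<in> T" and max: "\<And>u. u \<in> T \<Longrightarrow> rk (snd u) \<le> rk (snd t)"
    using obtains_MAX[of T "rk \<circ> snd"] by (metis Max_ge comp_apply finite_imageI imageI)
  have "t \<in> \<lceil>\<lceil>R\<rceil>\<rceil>"
    using t max by (fastforce simp: maxels_def T_def preceq_iff prec_iff)
  with t show ?thesis
    by (auto simp: T_def)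
qed

text \<open>A maximal element of \<open>R\<close> equals the element of \<open>R'\<close> above it.
  Conversely, an element of \<open>R\<close> strictly above a maximal element of \<open>R'\<close>
  would itself lie below some element of \<open>R'\<close>.\<close>

lemma maxels_eq_of_cofinal_subset:
  assumes "R' \<subseteq> R" "\<And>s. s \<in> R \<Longrightarrow> \<exists>s'\<in>R'. s \<preceq> s'"
  shows "\<lceil>\<lceil>R\<rceil>\<rceil> = \<lceil>\<lceil>R'\<rceil>\<rceil>"
proof (rule antisym)
  show "\<lceil>\<lceil>R\<rceil>\<rceil> \<subseteq> \<lceil>\<lceil>R'\<rceil>\<rceil>"
    using assms unfolding maxels_def preceq_def by blast
  show "\<lceil>\<lceil>R'\<rceil>\<rceil> \<subseteq> \<lceil>\<lceil>R\<rceil>\<rceil>"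
    using assms prec_preceq_trans unfolding maxels_def by blast
qed

text \<open>Different fibres are incomparable, and within one fibre maximality excludes strict
  comparisons.\<close>

lemma antichain_Union_maxels_fibres:
  assumes "\<And>v s. v \<in> I \<Longrightarrow> s \<in> F v \<Longrightarrow> fst s = v"
  shows "antichain (\<Union>v\<in>I. \<lceil>\<lceil>F v\<rceil>\<rceil>)"
  unfolding antichain_def
proof (intro ballI impI)
  fix s t
  assume "s \<in> (\<Union>v\<in>I. \<lceil>\<lceil>F v\<rceil>\<rceil>)" "t \<in> (\<Union>v\<in>I. \<lceil>\<lceil>F v\<rceil>\<rceil>)" "s \<noteq> t"
  then obtain v w where "v \<in> I" "w \<in> I" "s \<in> \<lceil>\<lceil>F v\<rceil>\<rceil>" "t \<in> \<lceil>\<lceil>F w\<rceil>\<rceil>"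
    by auto
  then show "\<not> s \<preceq> t \<and> \<not> t \<preceq> s"
    using assms[of v s] assms[of w t] \<open>s \<noteq> t\<close>
    by (auto simp: maxels_def preceq_def) (auto simp: prec_iff)
qed

lemma closed_in_iff_below_maxels:
  assumes "closed_in S U" "finite S" "s \<in> S"
  shows "s \<in> U \<longleftrightarrow> (\<exists>t\<in>\<lceil>\<lceil>U\<rceil>\<rceil>. s \<preceq> t)"
  using assms maxels_cofinal[of U s] maxels_subset[of U] finite_subset[of U S]
  unfolding closed_in_def by blast

section \<open>Iterated meets\<close>

lemma is_glb_of_preceq: "s \<in> S \<Longrightarrow> s \<preceq> t \<Longrightarrow> is_glb S s t s \<and> is_glb S t s s"
  by (auto simp: is_glb_def preceq_refl)

text \<open>Together with \<open>list_meet_greatest\<close> this describes the down-closure of an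
  iterated meet as the intersection of the down-closures of its factors, without computing any
  element of it.\<close>

lemma list_meet_below:
  assumes "g \<in> list_meet S Rs" "Rs \<noteq> []" "R \<in> set Rs"
  shows "\<exists>s\<in>R. g \<preceq> s"
  using assms
proof (induction S Rs arbitrary: g rule: list_meet.induct)
  case (3 S R\<^sub>1 R\<^sub>2 Rs)
  then obtain s t where "s \<in> R\<^sub>1" "t \<in> list_meet S (R\<^sub>2 # Rs)" "is_glb S s t g"
    by (auto simp: set_meet_def)
  then have "g \<preceq> s" "g \<preceq> t"
    by (auto simp: is_glb_def)
  consider "R = R\<^sub>1" | "R \<in> set (R\<^sub>2 # Rs)"
    using "3.prems"(3) by auto
  then show ?case
  proof cases
    case 1
    then show ?thesis
      using \<open>s \<in> R\<^sub>1\<close> \<open>g \<preceq> s\<close> by blast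
  next
    case 2
    then obtain u where "u \<in> R" "t \<preceq> u"
      using "3.IH"[OF \<open>t \<in> list_meet S (R\<^sub>2 # Rs)\<close>] by blast
    then show ?thesis
      using preceq_trans[OF \<open>g \<preceq> t\<close>] by blast
  qed
qed (auto intro: preceq_refl)

lemma list_meet_subset:
  assumes "Rs \<noteq> []" "\<And>R. R \<in> set Rs \<Longrightarrow> R \<subseteq> S"
  shows "list_meet S Rs \<subseteq> S"
  using assms by (induction S Rs rule: list_meet.induct) (auto simp: set_meet_def is_glb_def)

lemma list_meet_greatest:
  assumes "Rs \<noteq> []" "\<And>R. R \<in> set Rs \<Longrightarrow> R \<subseteq> S" "\<And>R. R \<in> set Rs \<Longrightarrow> \<exists>s\<in>R. h \<preceq> s"
  shows "\<exists>g\<in>list_meet S Rs. h \<preceq> g"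
  using assms
proof (induction S Rs rule: list_meet.induct)
  case (3 S R\<^sub>1 R\<^sub>2 Rs)
  obtain s where s: "s \<in> R\<^sub>1" "h \<preceq> s"
    using "3.prems"(3)[of R\<^sub>1] by auto
  obtain t where t: "t \<in> list_meet S (R\<^sub>2 # Rs)" "h \<preceq> t"
    using "3.IH" "3.prems" by (auto simp: Ball_def)
  have "s \<in> S" "t \<in> S"
    using s t "3.prems"(2) list_meet_subset[of "R\<^sub>2 # Rs" S] by auto
  \<comment> \<open>The common lower bound \<open>h\<close> puts \<open>s\<close> and
    \<open>t\<close> in the same fibre, a chain, so their meet is the smaller of the two.\<close>
  moreover have "s \<preceq> t \<or> t \<preceq> s"
    using s t by (auto simp: preceq_iff)
  ultimately have "is_glb S s t s \<or> is_glb S s t t"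
    using is_glb_of_preceq by blast
  with s t show ?case
    unfolding list_meet.simps set_meet_def by blast
qed auto

text \<open>Hides the choice of an enumeration: from here on only the set of its entries
  matters.\<close>

lemma big_meet_eq_list_meet:
  assumes "finite I" "I \<noteq> {}"
  obtains xs where "xs \<noteq> []" "set xs = I" "big_meet S F I = list_meet S (map F xs)"
proof -
  define xs where "xs = (SOME xs. distinct xs \<and> set xs = I)"
  have "distinct xs \<and> set xs = I"
    unfolding xs_def
    by (rule someI_ex[of "\<lambda>xs. distinct xs \<and> set xs = I"])
      (use finite_distinct_list[OF assms(1)] in blast)
  moreover have "big_meet S F I = list_meet S (map F xs)"
    by (simp add: big_meet_def xs_def)
  ultimately show thesis
    using that[of xs] assms(2) by auto
qed

lemma big_meet_below:
  assumes "finite I" "g \<in> big_meet S F I" "i \<in> I"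
  shows "\<exists>s\<in>F i. g \<preceq> s"
proof -
  obtain xs where "xs \<noteq> []" "set xs = I" "big_meet S F I = list_meet S (map F xs)"
    using big_meet_eq_list_meet[of I] assms by blast
  then show ?thesis
    using list_meet_below[of g S "map F xs" "F i"] assms by auto
qed

lemma big_meet_subset:
  assumes "finite I" "I \<noteq> {}" "\<And>i. i \<in> I \<Longrightarrow> F i \<subseteq> S"
  shows "big_meet S F I \<subseteq> S"
proof -
  obtain xs where "xs \<noteq> []" "set xs = I" "big_meet S F I = list_meet S (map F xs)"
    using big_meet_eq_list_meet[OF assms(1,2)] by blast
  then show ?thesis
    using list_meet_subset[of "map F xs" S] assms(3) by auto
qed

lemma big_meet_greatest:
  assumes "finite I" "I \<noteq> {}" "\<And>i. i \<in> I \<Longrightarrow> F i \<subseteq> S" "\<And>i. i \<in> I \<Longrightarrow> \<exists>s\<in>F i. h \<preceq> s"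
  shows "\<exists>g\<in>big_meet S F I. h \<preceq> g"
proof -
  obtain xs where "xs \<noteq> []" "set xs = I" "big_meet S F I = list_meet S (map F xs)"
    using big_meet_eq_list_meet[OF assms(1,2)] by blast
  then show ?thesis
    using list_meet_greatest[of "map F xs" S h] assms(3,4) by fastforce
qed

theorem proposition13:
  fixes V0 V1 :: "'v set" and E :: "('v \<times> 'v) set"
    and \<alpha> :: "'v \<Rightarrow> nat" and d :: nat
    and M :: "nat set" and S U A :: "('v \<times> nat) set"
  assumes "game_structure V0 V1 E"
    and "\<alpha> \<in> V0 \<union> V1 \<rightarrow> {0..d}"
    and "M = {0..d}"
    and "S = (V0 \<union> V1) \<times> M"
    and "closed_in S U"
    and "A = \<lceil>\<lceil>U\<rceil>\<rceil>"
  shows "closed_in S (Cpre0 (V0 \<times> M) (V1 \<times> M) (ext_edges E \<alpha> M) U) \<and>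
    antichain (B0 d V0 E \<alpha> A) \<and>
    antichain (B1 S d V1 E \<alpha> A) \<and>
    \<lceil>\<lceil>Cpre0 (V0 \<times> M) (V1 \<times> M) (ext_edges E \<alpha> M) U\<rceil>\<rceil> =
      \<lceil>\<lceil>B0 d V0 E \<alpha> A \<union> B1 S d V1 E \<alpha> A\<rceil>\<rceil>"
proof -
  interpret game_structure V0 V1 E by fact
  let ?C = "Cpre0 (V0 \<times> M) (V1 \<times> M) (ext_edges E \<alpha> M) U"
  \<comment> \<open>\<open>D v v'\<close> holds the bounds that the successor \<open>v'\<close>
    imposes on \<open>v\<close>. A free choice of successor unites them in \<open>D0\<close>; the
    opponent's choice intersects their down-closures, via the meet in \<open>D1\<close>.\<close>
  define D where "D v v' = {(v, k) | k m'. (v', m') \<in> A \<and> down d m' (\<alpha> v) = Some k}" for v v'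
  define D0 where "D0 v = (\<Union>v'\<in>{v'. (v, v') \<in> E}. D v v')" for v
  define D1 where "D1 v = big_meet S (\<lambda>v'. \<lceil>\<lceil>D v v'\<rceil>\<rceil>) {v'. (v, v') \<in> E}" for v
  have B0: "B0 d V0 E \<alpha> A = (\<Union>v\<in>V0. \<lceil>\<lceil>D0 v\<rceil>\<rceil>)"
    unfolding B0_def D0_def D_def by (intro SUP_cong refl arg_cong[where f = maxels]) auto
  have B1: "B1 S d V1 E \<alpha> A = (\<Union>v\<in>V1. \<lceil>\<lceil>D1 v\<rceil>\<rceil>)"
    unfolding B1_def D1_def D_def ..
  have \<alpha>: "\<alpha> v \<le> d" if "v \<in> V0 \<union> V1" for v
    using assms(2) that by auto
  have "finite S"
    using assms(3,4) finite_V0 finite_V1 by simp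
  have AS: "A \<subseteq> S"
    using assms(5,6) maxels_subset by (auto simp: closed_in_def)
  have DS: "D v v' \<subseteq> S" if "v \<in> V0 \<union> V1" for v v'
  proof
    fix s assume "s \<in> D v v'"
    then obtain k m' where s: "s = (v, k)" "(v', m') \<in> A" "down d m' (\<alpha> v) = Some k"
      by (auto simp: D_def)
    then have "k \<le> d"
      using down_le[of m' d "\<alpha> v" k] AS \<alpha>[OF that] assms(3,4) by auto
    with s that show "s \<in> S"
      using assms(3,4) by simp
  qed
  have fin_D: "finite (D v v')" if "v \<in> V0 \<union> V1" for v v'
    using DS[OF that] \<open>finite S\<close> finite_subset by blast
  have fst_D: "fst s = v" if "s \<in> D v v'" for s v v'
    using that by (auto simp: D_def)
  have succ: "finite {v'. (v, v') \<in> E}" "{v'. (v, v') \<in> E} \<noteq> {}" if "v \<in> V0 \<union> V1" for v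
    using that edges total finite_V0 finite_V1
    by (auto intro: finite_subset[of _ "V0 \<union> V1"])
  \<comment> \<open>The link between game and order: closedness of \<open>U\<close> reduces
    membership to lying below an element of \<open>A\<close>, and adjointness moves the maximum to
    the other side as \<open>down\<close>.\<close>
  have U_iff: "(v', max m (\<alpha> v)) \<in> U \<longleftrightarrow> (\<exists>s\<in>D v v'. (v, m) \<preceq> s)"
    if "(v, v') \<in> E" "m \<in> M" for v v' m
  proof -
    have v: "v \<in> V0 \<union> V1" "v' \<in> V0 \<union> V1"
      using that(1) edges by auto
    have "(v', max m (\<alpha> v)) \<in> S"
      using v \<alpha> that(2) assms(3,4) by auto
    then have "(v', max m (\<alpha> v)) \<in> U \<longleftrightarrow> (\<exists>m'. (v', m') \<in> A \<and> rk (max m (\<alpha> v)) \<le> rk m')"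
      using closed_in_iff_below_maxels[OF assms(5) \<open>finite S\<close>] assms(6)
      by (fastforce simp: preceq_iff)
    also have "\<dots> \<longleftrightarrow>
        (\<exists>m'. (v', m') \<in> A \<and> (\<exists>k. down d m' (\<alpha> v) = Some k \<and> rk m \<le> rk k))"
    proof -
      have "m' \<le> d" if "(v', m') \<in> A" for m'
        using that AS assms(3,4) by auto
      then show ?thesis
        using down_adjoint[of m d _ "\<alpha> v"] \<alpha>[OF v(1)] that(2) assms(3) by auto
    qed
    also have "\<dots> \<longleftrightarrow> (\<exists>s\<in>D v v'. (v, m) \<preceq> s)"
      by (auto simp: D_def preceq_iff)
    finally show ?thesis .
  qed
  \<comment> \<open>Since \<open>\<alpha> v \<le> d\<close>, the updated memory stays in
    \<open>M\<close>, so every edge of \<open>E\<close> lifts from every \<open>m\<close> in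
    \<open>M\<close>.\<close>
  have ext: "((v, m), s) \<in> ext_edges E \<alpha> M \<longleftrightarrow>
      (\<exists>v'. (v, v') \<in> E \<and> m \<in> M \<and> s = (v', max m (\<alpha> v)))" for v m s
    using \<alpha> edges assms(3) by (fastforce simp: ext_edges_def)
  \<comment> \<open>Disjointness of \<open>V0\<close> and \<open>V1\<close> ensures that only one
    half of \<open>Cpre0\<close> can contain \<open>(v, m)\<close>.\<close>
  have C0: "(v, m) \<in> ?C \<longleftrightarrow> m \<in> M \<and> (\<exists>s\<in>D0 v. (v, m) \<preceq> s)" if "v \<in> V0" for v m
    using that disjoint U_iff by (auto simp: Cpre0_def ext D0_def)
  have C1: "(v, m) \<in> ?C \<longleftrightarrow> m \<in> M \<and> (\<forall>v'. (v, v') \<in> E \<longrightarrow> (\<exists>s\<in>D v v'. (v, m) \<preceq> s))"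
    if "v \<in> V1" for v m
    using that disjoint U_iff by (auto simp: Cpre0_def ext)
  have CS: "?C \<subseteq> S"
    using assms(4) by (auto simp: Cpre0_def)
  have D1_below: "\<exists>s\<in>D v v'. g \<preceq> s" if "v \<in> V1" "(v, v') \<in> E" "g \<in> D1 v" for v v' g
    using big_meet_below[OF succ(1)[of v], of g S "\<lambda>v'. \<lceil>\<lceil>D v v'\<rceil>\<rceil>" v'] that
      maxels_subset[of "D v v'"]
    by (auto simp: D1_def)
  have D1S: "D1 v \<subseteq> S" if "v \<in> V1" for v
    unfolding D1_def using that DS maxels_subset succ[of v] by (intro big_meet_subset) blast+
  have D1_greatest: "\<exists>g\<in>D1 v. h \<preceq> g"
    if v: "v \<in> V1" and h: "\<And>v'. (v, v') \<in> E \<Longrightarrow> \<exists>s\<in>D v v'. h \<preceq> s" for v h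
    unfolding D1_def
  proof (rule big_meet_greatest)
    show "\<lceil>\<lceil>D v v'\<rceil>\<rceil> \<subseteq> S" for v'
      using v DS maxels_subset by blast
    show "\<exists>s\<in>\<lceil>\<lceil>D v v'\<rceil>\<rceil>. h \<preceq> s" if v': "v' \<in> {v'. (v, v') \<in> E}" for v'
    proof -
      obtain s where "s \<in> D v v'" "h \<preceq> s"
        using v' h by blast
      \<comment> \<open>The meet in \<open>D1\<close> is formed from maximal elements only, so the
        bound \<open>s\<close> is raised to one of them.\<close>
      with maxels_cofinal[of "D v v'" s] fin_D[of v v'] v show ?thesis
        using preceq_trans by blast
    qed
  qed (use succ v in auto)
  have fst_D0: "fst s = v" if "s \<in> D0 v" for s v
    using that fst_D unfolding D0_def by blast
  \<comment> \<open>The fibre is read off from a bound in some \<open>D v v'\<close>, which exists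
    because \<open>v\<close> has a successor.\<close>
  have fst_D1: "fst s = v" if v: "v \<in> V1" and s: "s \<in> D1 v" for s v
  proof -
    obtain v' where "(v, v') \<in> E"
      using succ(2)[of v] v by blast
    then obtain t where "t \<in> D v v'" "s \<preceq> t"
      using D1_below[OF v _ s] by blast
    then show ?thesis
      using fst_D by (metis preceq_iff)
  qed
  have D0C: "D0 v \<subseteq> ?C" if "v \<in> V0" for v
  proof
    fix s assume s: "s \<in> D0 v"
    then have "s \<in> S"
      using DS that by (auto simp: D0_def)
    moreover obtain m where m: "s = (v, m)"
      using fst_D0[OF s] by (cases s) auto
    ultimately show "s \<in> ?C"
      \<comment> \<open>Here \<open>s\<close> serves as its own bound in
        \<open>D0 v\<close>.\<close>
      using s C0[OF \<open>v \<in> V0\<close>, of m] preceq_refl[of s] assms(4) by blast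
  qed
  have D1C: "D1 v \<subseteq> ?C" if "v \<in> V1" for v
  proof
    fix s assume s: "s \<in> D1 v"
    then have "s \<in> S"
      using D1S that by auto
    moreover obtain m where m: "s = (v, m)"
      using fst_D1[OF \<open>v \<in> V1\<close> s] by (cases s) auto
    ultimately show "s \<in> ?C"
      using s C1[OF \<open>v \<in> V1\<close>, of m] D1_below[OF \<open>v \<in> V1\<close>] assms(4) by blast
  qed

  have "closed_in S ?C"
    unfolding closed_in_def
  proof (intro conjI ballI impI CS)
    fix s s' assume s: "s \<in> ?C" "s' \<in> S" "s' \<preceq> s"
    obtain v m m' where [simp]: "s = (v, m)" "s' = (v, m')"
      using s(3) by (cases s; cases s') (auto simp: preceq_iff)
    have "m' \<in> M" "v \<in> V0 \<or> v \<in> V1"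
      using s(2) assms(4) by auto
    \<comment> \<open>By \<open>C0\<close> and \<open>C1\<close>, membership only asks for bounds
      from above, and these pass down to \<open>s'\<close> by transitivity.\<close>
    then show "s' \<in> ?C"
      using s C0[of v] C1[of v] preceq_trans[of "(v, m')" "(v, m)"] by simp blast
  qed
  moreover have "antichain (B0 d V0 E \<alpha> A)"
    unfolding B0 by (intro antichain_Union_maxels_fibres fst_D0)
  moreover have "antichain (B1 S d V1 E \<alpha> A)"
    unfolding B1 by (intro antichain_Union_maxels_fibres fst_D1)
  moreover have "\<lceil>\<lceil>?C\<rceil>\<rceil> = \<lceil>\<lceil>B0 d V0 E \<alpha> A \<union> B1 S d V1 E \<alpha> A\<rceil>\<rceil>"
  proof (rule maxels_eq_of_cofinal_subset)
    show "B0 d V0 E \<alpha> A \<union> B1 S d V1 E \<alpha> A \<subseteq> ?C"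
      unfolding B0 B1 using D0C D1C maxels_subset by blast
  next
    \<comment> \<open>Cofinality: \<open>s\<close> lies below an element of \<open>D0 v\<close> or
      \<open>D1 v\<close>, and finiteness places a maximal element above that one.\<close>
    fix s assume s: "s \<in> ?C"
    obtain v m where m: "s = (v, m)"
      by (cases s)
    consider "v \<in> V0" | "v \<in> V1"
      using s CS assms(4) m by auto
    then show "\<exists>s'\<in>B0 d V0 E \<alpha> A \<union> B1 S d V1 E \<alpha> A. s \<preceq> s'"
    proof cases
      case 1
      then obtain t where "t \<in> D0 v" "s \<preceq> t"
        using s C0 m by blast
      moreover have "finite (D0 v)"
        by (rule finite_subset[OF subset_trans[OF D0C[OF 1] CS] \<open>finite S\<close>])
      ultimately show ?thesis
        unfolding B0 using 1 maxels_cofinal[of "D0 v" t] preceq_trans by blast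
    next
      case 2
      then obtain t where "t \<in> D1 v" "s \<preceq> t"
        using s C1[of v m] D1_greatest[of v s] m by blast
      moreover have "finite (D1 v)"
        by (rule finite_subset[OF D1S[OF 2] \<open>finite S\<close>])
      ultimately show ?thesis
        unfolding B1 using 2 maxels_cofinal[of "D1 v" t] preceq_trans by blast
    qed
  qed
  ultimately show ?thesis
    by blast
qed

end
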